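(* For every $\beta > 2$ there is a dense set of $\alpha \in [0,1)$ such that, for the intermediate beta shift associated to $(\alpha,\beta)$ with lexicographically smallest sequence $a$ and lexicographically largest sequence $b$, the set $$\mathsf{D}(a) = \{ n \in \mathbb{N} : (b_1,\dots,b_n) = (a_j,\dots,a_{j+n-1}) \text{ for some } j \in \mathbb{N} \}$$ is bounded.
   Context: $\mathbb{N} = \{1,2,3,\dots\}$. For $0 \le \alpha < 1$ and $\beta > 1$ define $F : [0,1) \to [0,1)$ by $F(x) = \beta x + \alpha - \lfloor \beta x + \alpha \rfloor$. Put $\ell = \lceil \alpha + \beta \rceil - 1$ and partition $[0,1)$ into $J_0 = [0, \frac{1-\alpha}{\beta})$, $J_i = [\frac{i-\alpha}{\beta}, \frac{i+1-\alpha}{\beta})$ for $0 < i < \ell$, and $J_\ell = [\frac{\ell-\alpha}{\beta}, 1)$. For $x \in [0,1)$ let $\Omega(x) \in \{0,\dots,\ell\}^{\mathbb{N}}$ be the sequence with $\Omega(x)_n = i$ if and only if $F^{n-1}(x) \in J_i$. The intermediate beta shift $\Sigma$ associated to $(\alpha,\beta)$ is the closure of $\Omega([0,1))$ in $\{0,\dots,\ell\}^{\mathbb{N}}$ (product topology). The sequences $a$ and $b$ (which depend on $\alpha$ and $\beta$) are the infimum and supremum of $\Sigma$ in the lexicographic order; equivalently $a = \Omega(0)$ and $b = \lim_{x \nearrow 1} \Omega(x)$. *)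

theory Defs
  imports "HOL-Analysis.Analysis" "HOL-Library.Fun_Lexorder"
begin

(* Sequences indexed by {1,2,3,...} are represented as functions on nat starting at
   index 0, so the n-th term x_n of a sequence x is the value x (n - 1). *)

definition beta_map :: "real \<Rightarrow> real \<Rightarrow> real \<Rightarrow> real" where
  "beta_map \<alpha> \<beta> x = \<beta> * x + \<alpha> - of_int \<lfloor>\<beta> * x + \<alpha>\<rfloor>"

definition beta_top :: "real \<Rightarrow> real \<Rightarrow> nat" where
  "beta_top \<alpha> \<beta> = nat (\<lceil>\<alpha> + \<beta>\<rceil> - 1)"

definition beta_interval :: "real \<Rightarrow> real \<Rightarrow> nat \<Rightarrow> real set" where
  "beta_interval \<alpha> \<beta> i =
     (if i = 0 then {0 ..< (1 - \<alpha>) / \<beta>}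
      else if i < beta_top \<alpha> \<beta> then {(real i - \<alpha>) / \<beta> ..< (real i + 1 - \<alpha>) / \<beta>}
      else {(real i - \<alpha>) / \<beta> ..< 1})"

definition itinerary :: "real \<Rightarrow> real \<Rightarrow> real \<Rightarrow> nat \<Rightarrow> nat" where
  "itinerary \<alpha> \<beta> x n =
     (THE i. i \<le> beta_top \<alpha> \<beta> \<and> (beta_map \<alpha> \<beta> ^^ n) x \<in> beta_interval \<alpha> \<beta> i)"

(* The closure is taken in nat => nat with the product of the discrete topologies.  The
   sequences with all values at most beta_top form a closed subset of that space, so this
   is also the closure in the full shift over {0, ..., beta_top}. *)

definition beta_shift :: "real \<Rightarrow> real \<Rightarrow> (nat \<Rightarrow> nat) set" where
  "beta_shift \<alpha> \<beta> = closure (itinerary \<alpha> \<beta> ` {0..<1})"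

definition lex_le :: "(nat \<Rightarrow> nat) \<Rightarrow> (nat \<Rightarrow> nat) \<Rightarrow> bool" where
  "lex_le x y \<longleftrightarrow> less_fun x y \<or> x = y"

definition is_lex_smallest :: "(nat \<Rightarrow> nat) set \<Rightarrow> (nat \<Rightarrow> nat) \<Rightarrow> bool" where
  "is_lex_smallest S a \<longleftrightarrow> a \<in> S \<and> (\<forall>x\<in>S. lex_le a x)"

definition is_lex_largest :: "(nat \<Rightarrow> nat) set \<Rightarrow> (nat \<Rightarrow> nat) \<Rightarrow> bool" where
  "is_lex_largest S b \<longleftrightarrow> b \<in> S \<and> (\<forall>x\<in>S. lex_le x b)"

definition prefix_lengths :: "(nat \<Rightarrow> nat) \<Rightarrow> (nat \<Rightarrow> nat) \<Rightarrow> nat set" where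
  "prefix_lengths b a = {n. n \<ge> 1 \<and> (\<exists>j. \<forall>i<n. b i = a (j + i))}"

end

theory Submission
  imports Defs
begin

text \<open>
  If no parameter in an interval \<open>{c<..<d}\<close> made \<open>0\<close> periodic, the \<open>n\<close>-th iterate of \<open>0\<close> would
  never cross a discontinuity, hence would be an affine function of \<open>\<alpha>\<close> of slope
  \<open>1 + \<beta> + \<dots> + \<beta>\<^sup>n\<^sup>-\<^sup>1 \<ge> n\<close> on all of \<open>{c<..<d}\<close>, which is impossible for large \<open>n\<close> because its
  values lie in \<open>{0..<1}\<close>. So \<open>0\<close> is periodic for a dense set of \<open>\<alpha>\<close>. For such \<open>\<alpha>\<close> the orbit of
  \<open>0\<close> is finite and therefore stays at some distance \<open>\<delta> > 0\<close> from \<open>1\<close>; since a common prefix of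
  length \<open>n\<close> of \<open>b\<close> and the itinerary of \<open>x\<close> forces \<open>\<beta>\<^sup>n (1 - x) \<le> 1\<close>, the set of prefix lengths
  is bounded.
\<close>

section \<open>The lexicographic order and the product topology\<close>

lemma not_lex_leE:
  assumes "\<not> lex_le x y"
  obtains k where "y k < x k" "\<And>i. i < k \<Longrightarrow> y i = x i"
proof -
  have ne: "x \<noteq> y" and nl: "\<not> less_fun x y"
    using assms by (auto simp: lex_le_def)
  define k where "k = (LEAST k. x k \<noteq> y k)"
  have k: "x k \<noteq> y k"
    unfolding k_def by (rule LeastI_ex) (use ne in auto)
  have eq: "x i = y i" if "i < k" for i
    using not_less_Least[of i "\<lambda>k. x k \<noteq> y k"] that by (auto simp: k_def)
  have "\<not> x k < y k"
    using nl eq unfolding less_fun_def by blast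
  with k eq show thesis
    by (intro that[of k]) auto
qed

text \<open>If the order failed, the first index where the sequences differ would violate the
  assumption; a weak inequality after each common prefix is therefore enough.\<close>

lemma lex_leI:
  assumes "\<And>k. (\<And>i. i < k \<Longrightarrow> x i = y i) \<Longrightarrow> x k \<le> y k"
  shows "lex_le x y"
  by (rule ccontr, erule not_lex_leE) (use assms in \<open>metis not_less\<close>)

lemma lex_le_not_gt:
  assumes "lex_le x y" "\<And>i. i < k \<Longrightarrow> x i = y i"
  shows "x k \<le> y k"
proof (cases "x = y")
  case False
  then obtain m where m: "x m < y m" "\<And>i. i < m \<Longrightarrow> x i = y i"
    using assms(1) by (auto simp: lex_le_def less_fun_def)
  then have "k \<le> m"
    using assms(2)[of m] by (cases "m < k") auto
  with m show ?thesis
    by (cases "k = m") auto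
qed simp

text \<open>The coordinates are discrete, so fixing finitely many of them cuts out an open
  neighbourhood of \<open>z\<close>.\<close>

lemma closure_agree_prefix:
  fixes z :: "nat \<Rightarrow> 'a::discrete_topology"
  assumes "z \<in> closure S"
  obtains s where "s \<in> S" "\<And>i. i \<le> k \<Longrightarrow> s i = z i"
proof -
  define U where "U = (\<Inter>i\<in>{..k}. (\<lambda>w. w i) -` {z i})"
  have "open U"
    unfolding U_def
    by (intro open_INT ballI open_vimage continuous_on_product_coordinates open_discrete) simp
  moreover have "z \<in> U"
    by (simp add: U_def)
  ultimately have "U \<inter> S \<noteq> {}"
    using assms open_Int_closure_eq_empty[of U S] by blast
  then show thesis
    using that by (auto simp: U_def)
qed

text \<open>A failure of the order already shows on a finite prefix of \<open>z\<close>, and some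
  element of \<open>S\<close> shares that prefix.\<close>

lemma lex_le_closure_lower:
  assumes "\<And>s. s \<in> S \<Longrightarrow> lex_le a s" "z \<in> closure S"
  shows "lex_le a z"
proof (rule lex_leI)
  fix k assume "\<And>i. i < k \<Longrightarrow> a i = z i"
  moreover obtain s where "s \<in> S" "\<And>i. i \<le> k \<Longrightarrow> s i = z i"
    using closure_agree_prefix[OF assms(2)] by metis
  ultimately show "a k \<le> z k"
    using lex_le_not_gt[OF assms(1), of s k] by auto
qed

lemma lex_le_closure_upper:
  assumes "\<And>s. s \<in> S \<Longrightarrow> lex_le s b" "z \<in> closure S"
  shows "lex_le z b"
proof (rule lex_leI)
  fix k assume "\<And>i. i < k \<Longrightarrow> z i = b i"
  moreover obtain s where "s \<in> S" "\<And>i. i \<le> k \<Longrightarrow> s i = z i"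
    using closure_agree_prefix[OF assms(2)] by metis
  ultimately show "z k \<le> b k"
    using lex_le_not_gt[OF assms(1), of s k] by auto
qed

section \<open>Itineraries\<close>

lemma beta_map_range: "beta_map \<alpha> \<beta> x \<in> {0..<1}"
  unfolding beta_map_def atLeastLessThan_iff by linarith

lemma beta_map_iter_range: "x \<in> {0..<1} \<Longrightarrow> (beta_map \<alpha> \<beta> ^^ n) x \<in> {0..<1}"
  using beta_map_range by (cases n) (simp_all only: funpow.simps o_apply id_apply)

text \<open>Clearing the denominator turns the endpoints into consecutive integers. The truncated
  first and last intervals fit the same formula because \<open>\<beta> * u + \<alpha>\<close> stays
  in [0, \<open>beta_top\<close> + 1).\<close>

lemma mem_beta_interval_iff:
  assumes "\<alpha> \<in> {0..<1}" "\<beta> > 1" "u \<in> {0..<1}" "i \<le> beta_top \<alpha> \<beta>"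
  shows "u \<in> beta_interval \<alpha> \<beta> i \<longleftrightarrow> \<lfloor>\<beta> * u + \<alpha>\<rfloor> = int i"
proof -
  have pos: "beta_top \<alpha> \<beta> \<ge> 1"
    using assms by (simp add: beta_top_def) linarith
  have "\<beta> * u < \<beta>" "0 \<le> \<beta> * u"
    using assms by auto
  moreover have "\<alpha> + \<beta> \<le> real (beta_top \<alpha> \<beta>) + 1"
    using assms unfolding beta_top_def by simp
  ultimately have "0 \<le> \<beta> * u + \<alpha>" "\<beta> * u + \<alpha> < real (beta_top \<alpha> \<beta>) + 1"
    using assms(1) by auto
  moreover have "u < (r - \<alpha>) / \<beta> \<longleftrightarrow> \<beta> * u + \<alpha> < r" "(r - \<alpha>) / \<beta> \<le> u \<longleftrightarrow> r \<le> \<beta> * u + \<alpha>" for r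
    using assms by (auto simp: field_simps)
  ultimately show ?thesis
    using assms pos unfolding beta_interval_def floor_eq_iff by auto
qed

lemma itinerary_eq:
  assumes "\<alpha> \<in> {0..<1}" "\<beta> > 1" "x \<in> {0..<1}"
  shows "itinerary \<alpha> \<beta> x n = nat \<lfloor>\<beta> * (beta_map \<alpha> \<beta> ^^ n) x + \<alpha>\<rfloor>"
proof -
  define u where "u = (beta_map \<alpha> \<beta> ^^ n) x"
  have u: "u \<in> {0..<1}"
    unfolding u_def by (rule beta_map_iter_range[OF assms(3)])
  have "\<beta> * u < \<beta>" "0 \<le> \<beta> * u"
    using assms u by auto
  then have nn: "\<lfloor>\<beta> * u + \<alpha>\<rfloor> \<ge> 0" and top: "nat \<lfloor>\<beta> * u + \<alpha>\<rfloor> \<le> beta_top \<alpha> \<beta>"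
    using assms unfolding beta_top_def by (simp, intro nat_mono, linarith)
  show ?thesis
    unfolding itinerary_def u_def[symmetric]
    using nn top by (intro the_equality) (auto simp: mem_beta_interval_iff[OF assms(1,2) u])
qed

lemma itinerary_eq_int:
  assumes "\<alpha> \<in> {0..<1}" "\<beta> > 1" "x \<in> {0..<1}"
  shows "int (itinerary \<alpha> \<beta> x n) = \<lfloor>\<beta> * (beta_map \<alpha> \<beta> ^^ n) x + \<alpha>\<rfloor>"
  using beta_map_iter_range[OF assms(3), of n \<alpha> \<beta>] assms by (simp add: itinerary_eq)

text \<open>The digit is exactly the integer part that \<open>beta_map\<close> removes, so points
  with equal digits move under the same affine branch of slope \<beta>.\<close>

lemma beta_map_iter_Suc:
  assumes "\<alpha> \<in> {0..<1}" "\<beta> > 1" "x \<in> {0..<1}"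
  shows "(beta_map \<alpha> \<beta> ^^ Suc n) x
    = \<beta> * (beta_map \<alpha> \<beta> ^^ n) x + \<alpha> - real (itinerary \<alpha> \<beta> x n)"
  using arg_cong[OF itinerary_eq_int[OF assms, of n], of real_of_int]
  by (simp add: beta_map_def)

lemma itinerary_shift: "itinerary \<alpha> \<beta> x (j + i) = itinerary \<alpha> \<beta> ((beta_map \<alpha> \<beta> ^^ j) x) i"
  by (simp add: itinerary_def funpow_add add.commute[of j i])

text \<open>Along a common prefix both orbits follow the same increasing affine branches, so their
  order survives until the digits differ.\<close>

lemma itinerary_mono:
  assumes "\<alpha> \<in> {0..<1}" "\<beta> > 1" "x \<in> {0..<1}" "y \<in> {0..<1}" "x \<le> y"
  shows "lex_le (itinerary \<alpha> \<beta> x) (itinerary \<alpha> \<beta> y)"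
proof (rule lex_leI)
  fix k assume eq: "\<And>i. i < k \<Longrightarrow> itinerary \<alpha> \<beta> x i = itinerary \<alpha> \<beta> y i"
  have "m \<le> k \<Longrightarrow> (beta_map \<alpha> \<beta> ^^ m) x \<le> (beta_map \<alpha> \<beta> ^^ m) y" for m
  proof (induction m)
    case (Suc m)
    then show ?case
      using assms eq[of m] unfolding beta_map_iter_Suc[OF assms(1,2,3)]
        beta_map_iter_Suc[OF assms(1,2,4)] by simp
  qed (use assms in simp)
  from this[of k] show "itinerary \<alpha> \<beta> x k \<le> itinerary \<alpha> \<beta> y k"
    using assms by (simp add: itinerary_eq nat_mono floor_mono)
qed

lemma itinerary_0_smallest:
  assumes "\<alpha> \<in> {0..<1}" "\<beta> > 1"
  shows "is_lex_smallest (beta_shift \<alpha> \<beta>) (itinerary \<alpha> \<beta> 0)"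
proof -
  have "itinerary \<alpha> \<beta> 0 \<in> beta_shift \<alpha> \<beta>"
    unfolding beta_shift_def by (rule subsetD[OF closure_subset]) auto
  then show ?thesis
    using itinerary_mono[OF assms, of 0]
    by (auto simp: is_lex_smallest_def beta_shift_def intro: lex_le_closure_lower[rotated])
qed

section \<open>The left limit of the itineraries at 1\<close>

text \<open>The left-continuous version of \<open>beta_map\<close>; its itinerary of \<open>1\<close> is the sequence \<open>b\<close>.\<close>

definition left_beta_map :: "real \<Rightarrow> real \<Rightarrow> real \<Rightarrow> real" where
  "left_beta_map \<alpha> \<beta> y = \<beta> * y + \<alpha> - of_int (\<lceil>\<beta> * y + \<alpha>\<rceil> - 1)"

definition left_itinerary :: "real \<Rightarrow> real \<Rightarrow> nat \<Rightarrow> nat" where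
  "left_itinerary \<alpha> \<beta> n = nat (\<lceil>\<beta> * (left_beta_map \<alpha> \<beta> ^^ n) 1 + \<alpha>\<rceil> - 1)"

lemma left_beta_map_range: "left_beta_map \<alpha> \<beta> y \<in> {0<..1}"
  unfolding left_beta_map_def greaterThanAtMost_iff by linarith

lemma left_beta_map_iter_range: "(left_beta_map \<alpha> \<beta> ^^ n) 1 \<in> {0<..1}"
proof (cases n)
  case (Suc m)
  then show ?thesis
    using left_beta_map_range[of \<alpha> \<beta> "(left_beta_map \<alpha> \<beta> ^^ m) 1"]
    by (simp only: funpow.simps o_apply)
qed simp

lemma left_itinerary_eq_int:
  assumes "\<alpha> \<in> {0..<1}" "\<beta> > 1"
  shows "int (left_itinerary \<alpha> \<beta> n) = \<lceil>\<beta> * (left_beta_map \<alpha> \<beta> ^^ n) 1 + \<alpha>\<rceil> - 1"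
proof -
  have "\<beta> * (left_beta_map \<alpha> \<beta> ^^ n) 1 > 0"
    using left_beta_map_iter_range[of n \<alpha> \<beta>] assms by auto
  with assms have "\<lceil>\<beta> * (left_beta_map \<alpha> \<beta> ^^ n) 1 + \<alpha>\<rceil> \<ge> 1"
    by auto
  then show ?thesis
    by (simp add: left_itinerary_def)
qed

lemma left_beta_map_iter_Suc:
  assumes "\<alpha> \<in> {0..<1}" "\<beta> > 1"
  shows "(left_beta_map \<alpha> \<beta> ^^ Suc n) 1
    = \<beta> * (left_beta_map \<alpha> \<beta> ^^ n) 1 + \<alpha> - real (left_itinerary \<alpha> \<beta> n)"
  using arg_cong[OF left_itinerary_eq_int[OF assms, of n], of real_of_int]
  by (simp add: left_beta_map_def)

text \<open>Equal digits subtract the same integer from both orbits, so each step multiplies their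
  difference by \<beta>.\<close>

lemma iter_diff_of_common_prefix:
  assumes "\<alpha> \<in> {0..<1}" "\<beta> > 1" "x \<in> {0..<1}"
    and "\<And>i. i < n \<Longrightarrow> itinerary \<alpha> \<beta> x i = left_itinerary \<alpha> \<beta> i"
  shows "(left_beta_map \<alpha> \<beta> ^^ n) 1 - (beta_map \<alpha> \<beta> ^^ n) x = \<beta> ^ n * (1 - x)"
  using assms(4)
proof (induction n)
  case (Suc n)
  from Suc.IH Suc.prems
  have IH: "(left_beta_map \<alpha> \<beta> ^^ n) 1 - (beta_map \<alpha> \<beta> ^^ n) x = \<beta> ^ n * (1 - x)"
    by simp
  have "(left_beta_map \<alpha> \<beta> ^^ Suc n) 1 - (beta_map \<alpha> \<beta> ^^ Suc n) x
    = \<beta> * ((left_beta_map \<alpha> \<beta> ^^ n) 1 - (beta_map \<alpha> \<beta> ^^ n) x)"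
    unfolding left_beta_map_iter_Suc[OF assms(1,2)] beta_map_iter_Suc[OF assms(1-3)]
    using Suc.prems[of n] by (simp add: algebra_simps)
  also have "\<dots> = \<beta> ^ Suc n * (1 - x)"
    unfolding IH by simp
  finally show ?case .
qed simp

text \<open>Both orbits stay in the unit interval, which caps the expanded difference. This limits
  how long a point away from 1 can imitate \<open>left_itinerary\<close>.\<close>

lemma common_prefix_bound:
  assumes "\<alpha> \<in> {0..<1}" "\<beta> > 1" "x \<in> {0..<1}"
    and "\<And>i. i < n \<Longrightarrow> itinerary \<alpha> \<beta> x i = left_itinerary \<alpha> \<beta> i"
  shows "\<beta> ^ n * (1 - x) \<le> 1"
proof -
  have "\<beta> ^ n * (1 - x) = (left_beta_map \<alpha> \<beta> ^^ n) 1 - (beta_map \<alpha> \<beta> ^^ n) x"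
    using iter_diff_of_common_prefix[OF assms] by simp
  also have "\<dots> \<le> 1"
    using left_beta_map_iter_range[of n \<alpha> \<beta>] beta_map_iter_range[OF assms(3), of n \<alpha> \<beta>]
    by simp
  finally show ?thesis .
qed

lemma itinerary_le_left_itinerary:
  assumes "\<alpha> \<in> {0..<1}" "\<beta> > 1" "x \<in> {0..<1}"
  shows "lex_le (itinerary \<alpha> \<beta> x) (left_itinerary \<alpha> \<beta>)"
proof (rule lex_leI)
  fix k assume eq: "\<And>i. i < k \<Longrightarrow> itinerary \<alpha> \<beta> x i = left_itinerary \<alpha> \<beta> i"
  \<comment> \<open>Strictness matters:
    \<open>\<lfloor>u\<rfloor> \<le> \<lceil>v\<rceil> - 1\<close> follows from u < v but fails when
    u = v is an integer.\<close>
  have "0 < \<beta> ^ k * (1 - x)"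
    using assms by simp
  then have "(beta_map \<alpha> \<beta> ^^ k) x < (left_beta_map \<alpha> \<beta> ^^ k) 1"
    using iter_diff_of_common_prefix[OF assms eq, of k] by simp
  then have "\<beta> * (beta_map \<alpha> \<beta> ^^ k) x + \<alpha> < \<beta> * (left_beta_map \<alpha> \<beta> ^^ k) 1 + \<alpha>"
    using assms by simp
  then have "\<lfloor>\<beta> * (beta_map \<alpha> \<beta> ^^ k) x + \<alpha>\<rfloor> \<le> \<lceil>\<beta> * (left_beta_map \<alpha> \<beta> ^^ k) 1 + \<alpha>\<rceil> - 1"
    by linarith
  then have "int (itinerary \<alpha> \<beta> x k) \<le> int (left_itinerary \<alpha> \<beta> k)"
    using itinerary_eq_int[OF assms] left_itinerary_eq_int[OF assms(1,2)] by simp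
  then show "itinerary \<alpha> \<beta> x k \<le> left_itinerary \<alpha> \<beta> k"
    by simp
qed

lemma eventually_floor_at_left:
  fixes \<beta> :: real
  assumes "\<beta> > 0"
  shows "\<forall>\<^sub>F x in at_left y. \<lfloor>\<beta> * x + \<alpha>\<rfloor> = \<lceil>\<beta> * y + \<alpha>\<rceil> - 1"
proof -
  \<comment> \<open>\<open>c\<close> is where \<open>\<beta> * x + \<alpha>\<close> meets the
    largest integer strictly below its value at \<open>y\<close>; it meets no integer strictly
    between \<open>c\<close> and \<open>y\<close>.\<close>
  define c where "c = (of_int (\<lceil>\<beta> * y + \<alpha>\<rceil> - 1) - \<alpha>) / \<beta>"
  have "real_of_int (\<lceil>\<beta> * y + \<alpha>\<rceil> - 1) < \<beta> * y + \<alpha>"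
    by linarith
  then have "c < y"
    using assms by (simp add: c_def field_simps)
  then have "\<forall>\<^sub>F x in at_left y. x \<in> {c<..<y}"
    by (rule eventually_at_left_real)
  then show ?thesis
  proof eventually_elim
    case (elim x)
    then have "real_of_int (\<lceil>\<beta> * y + \<alpha>\<rceil> - 1) < \<beta> * x + \<alpha>" "\<beta> * x + \<alpha> < \<beta> * y + \<alpha>"
      using assms by (auto simp: c_def field_simps)
    then show ?case
      by (subst floor_eq_iff) linarith
  qed
qed

text \<open>Just left of \<open>y\<close> the map is one increasing affine branch, so the limit is
  approached strictly from below. Having \<open>at_left\<close> on both sides is what allows
  iteration.\<close>

lemma filterlim_beta_map_at_left:
  assumes "\<beta> > 0"
  shows "filterlim (beta_map \<alpha> \<beta>) (at_left (left_beta_map \<alpha> \<beta> y)) (at_left y)"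
proof -
  let ?g = "\<lambda>x. \<beta> * x + \<alpha> - of_int (\<lceil>\<beta> * y + \<alpha>\<rceil> - 1)"
  have "(?g \<longlongrightarrow> left_beta_map \<alpha> \<beta> y) (at_left y)"
    unfolding left_beta_map_def by (intro tendsto_intros)
  moreover have "\<forall>\<^sub>F x in at_left y. ?g x \<in> {..<left_beta_map \<alpha> \<beta> y}"
    using assms by (auto simp: left_beta_map_def eventually_at_filter)
  ultimately have "filterlim ?g (at_left (left_beta_map \<alpha> \<beta> y)) (at_left y)"
    by (auto simp: filterlim_at elim: eventually_mono)
  moreover have "\<forall>\<^sub>F x in at_left y. ?g x = beta_map \<alpha> \<beta> x"
    using eventually_floor_at_left[OF assms, where \<alpha> = \<alpha>]
    by eventually_elim (simp add: beta_map_def)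
  ultimately show ?thesis
    by (rule filterlim_mono_eventually[OF _ order_refl order_refl])
qed

lemma filterlim_beta_map_iter_at_left:
  assumes "\<beta> > 0"
  shows "filterlim (beta_map \<alpha> \<beta> ^^ n) (at_left ((left_beta_map \<alpha> \<beta> ^^ n) 1)) (at_left 1)"
proof (induction n)
  case (Suc n)
  from filterlim_compose[OF filterlim_beta_map_at_left[OF assms] Suc] show ?case
    by (simp add: o_def)
qed (simp add: filterlim_ident id_def)

text \<open>Product convergence is coordinatewise, and in a discrete coordinate it means being
  eventually constant. Each digit stabilises because the iterates approach their limits from the
  left.\<close>

lemma itinerary_tendsto_left_itinerary:
  assumes "\<alpha> \<in> {0..<1}" "\<beta> > 1"
  shows "(itinerary \<alpha> \<beta> \<longlongrightarrow> left_itinerary \<alpha> \<beta>) (at_left 1)"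
proof -
  have "\<forall>\<^sub>F x in at_left 1. itinerary \<alpha> \<beta> x n = left_itinerary \<alpha> \<beta> n" for n
  proof -
    have "\<forall>\<^sub>F x in at_left 1. \<lfloor>\<beta> * (beta_map \<alpha> \<beta> ^^ n) x + \<alpha>\<rfloor>
        = \<lceil>\<beta> * (left_beta_map \<alpha> \<beta> ^^ n) 1 + \<alpha>\<rceil> - 1"
      using assms
      by (intro eventually_compose_filterlim[OF eventually_floor_at_left
            filterlim_beta_map_iter_at_left]) auto
    moreover have "\<forall>\<^sub>F x in at_left (1::real). x \<in> {0<..<1}"
      by (rule eventually_at_left_real) simp
    ultimately show ?thesis
      by eventually_elim (use assms in \<open>simp add: itinerary_eq left_itinerary_def\<close>)
  qed
  then show ?thesis
    unfolding limitin_canonical_iff[symmetric] euclidean_product_topology[symmetric]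
      limitin_componentwise
    by (simp add: tendsto_discrete)
qed

lemma left_itinerary_largest:
  assumes "\<alpha> \<in> {0..<1}" "\<beta> > 1"
  shows "is_lex_largest (beta_shift \<alpha> \<beta>) (left_itinerary \<alpha> \<beta>)"
proof -
  have "\<forall>\<^sub>F x in at_left (1::real). x \<in> {0<..<1}"
    by (rule eventually_at_left_real) simp
  then have "\<forall>\<^sub>F x in at_left 1. itinerary \<alpha> \<beta> x \<in> closure (itinerary \<alpha> \<beta> ` {0..<1})"
    by eventually_elim (rule subsetD[OF closure_subset], auto)
  then have "left_itinerary \<alpha> \<beta> \<in> beta_shift \<alpha> \<beta>"
    unfolding beta_shift_def
    by (intro Lim_in_closed_set[OF closed_closure _ _ itinerary_tendsto_left_itinerary[OF assms]])
      auto
  then show ?thesis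
    using itinerary_le_left_itinerary[OF assms]
    by (auto simp: is_lex_largest_def beta_shift_def intro: lex_le_closure_upper[rotated])
qed

section \<open>Periodicity of 0\<close>

lemma bdd_above_prefix_lengths_periodic:
  assumes "\<alpha> \<in> {0..<1}" "\<beta> > 1" "m > 0" "(beta_map \<alpha> \<beta> ^^ m) 0 = 0"
  shows "bdd_above (prefix_lengths (left_itinerary \<alpha> \<beta>) (itinerary \<alpha> \<beta> 0))"
proof -
  let ?x = "\<lambda>j. (beta_map \<alpha> \<beta> ^^ j) 0"
  have range: "?x j \<in> {0..<1}" for j
    by (rule beta_map_iter_range) simp
  \<comment> \<open>Periodicity leaves at most \<open>m\<close> orbit points, so the supremum of the
    orbit is attained and lies below 1.\<close>
  define M where "M = Max (?x ` {..<m})"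
  have "M \<in> ?x ` {..<m}"
    unfolding M_def using assms(3) by (intro Max_in) auto
  then have "M < 1"
    using range by auto
  have le_M: "?x j \<le> M" for j
    using assms(3) funpow_mod_eq[OF assms(4), of j, symmetric] by (auto simp: M_def intro!: Max_ge)
  \<comment> \<open>Every orbit point is at distance at least \<open>1 - M\<close> from 1, so beyond
    length \<open>N\<close> the bound of \<open>common_prefix_bound\<close> is violated at all of
    them.\<close>
  obtain N where N: "\<beta> ^ N * (1 - M) > 1"
    using real_arch_pow[OF assms(2), of "1 / (1 - M)"] \<open>M < 1\<close> by (auto simp: field_simps)
  have "n \<le> N" if "n \<in> prefix_lengths (left_itinerary \<alpha> \<beta>) (itinerary \<alpha> \<beta> 0)" for n
  proof (rule ccontr)
    assume "\<not> n \<le> N"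
    from that obtain j where
      "\<And>i. i < n \<Longrightarrow> left_itinerary \<alpha> \<beta> i = itinerary \<alpha> \<beta> 0 (j + i)"
      by (auto simp: prefix_lengths_def)
    \<comment> \<open>A block of the itinerary of 0 starting at \<open>j\<close> is a prefix of the
      itinerary of the \<open>j\<close>-th orbit point.\<close>
    then have "\<beta> ^ n * (1 - ?x j) \<le> 1"
      by (intro common_prefix_bound[OF assms(1,2) range]) (simp add: itinerary_shift)
    moreover have "\<beta> ^ N * (1 - M) \<le> \<beta> ^ n * (1 - ?x j)"
      using \<open>\<not> n \<le> N\<close> assms(2) \<open>M < 1\<close> le_M[of j]
      by (intro mult_mono power_increasing) auto
    ultimately show False
      using N by simp
  qed
  then show ?thesis
    by (rule bdd_aboveI)
qed

lemma exists_periodic_parameter: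
  fixes \<beta> c d :: real
  assumes "\<beta> \<ge> 1" "c < d"
  shows "\<exists>\<alpha>\<in>{c<..<d}. \<exists>m>0. (beta_map \<alpha> \<beta> ^^ m) 0 = 0"
proof (rule ccontr)
  assume "\<not> ?thesis"
  then have nz: "(beta_map \<alpha> \<beta> ^^ Suc n) 0 \<noteq> 0" if "\<alpha> \<in> {c<..<d}" for \<alpha> n
    using that by blast
  \<comment> \<open>A lower bound on the slope suffices: \<beta> \<ge> 1 turns s \<ge> n into
    \<open>\<beta> * s + 1 \<ge> n + 1\<close>.\<close>
  have affine: "\<exists>s t. s \<ge> real n \<and> (\<forall>\<alpha>\<in>{c<..<d}. (beta_map \<alpha> \<beta> ^^ n) 0 = s * \<alpha> + t)" for n
  proof (induction n)
    case (Suc n)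
    then obtain s t where s: "s \<ge> real n"
      and st: "\<And>\<alpha>. \<alpha> \<in> {c<..<d} \<Longrightarrow> (beta_map \<alpha> \<beta> ^^ n) 0 = s * \<alpha> + t"
      by blast
    define g where "g = (\<lambda>\<alpha>. \<beta> * (s * \<alpha> + t) + \<alpha>)"
    have map_eq: "(beta_map \<alpha> \<beta> ^^ Suc n) 0 = g \<alpha> - of_int \<lfloor>g \<alpha>\<rfloor>" if "\<alpha> \<in> {c<..<d}" for \<alpha>
      using st[OF that] by (simp add: beta_map_def g_def)
    \<comment> \<open>If the floor increased, \<open>g\<close> would take an integer value in
      between by the intermediate value theorem, and at that parameter the next iterate would be
      0.\<close>
    have floor_le: "\<lfloor>g y\<rfloor> \<le> \<lfloor>g x\<rfloor>" if xy: "x \<in> {c<..<d}" "y \<in> {c<..<d}" "x \<le> y" for x y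
    proof (rule ccontr)
      assume "\<not> \<lfloor>g y\<rfloor> \<le> \<lfloor>g x\<rfloor>"
      then have "g x \<le> of_int \<lfloor>g y\<rfloor>" "of_int \<lfloor>g y\<rfloor> \<le> g y"
        by linarith+
      moreover have "continuous_on {x..y} g"
        unfolding g_def by (intro continuous_intros)
      ultimately obtain \<alpha> where "x \<le> \<alpha>" "\<alpha> \<le> y" "g \<alpha> = of_int \<lfloor>g y\<rfloor>"
        using IVT'[of g x "of_int \<lfloor>g y\<rfloor>" y, OF _ _ xy(3)] by blast
      moreover from this have "\<alpha> \<in> {c<..<d}"
        using xy by auto
      ultimately show False
        using nz[of \<alpha> n] map_eq[of \<alpha>] by (simp del: funpow.simps)
    qed
    \<comment> \<open>Monotonicity gives the reverse inequality of floors, so one integer is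
      subtracted on the whole interval and the next iterate is again affine.\<close>
    have "mono g"
      using s assms(1) unfolding g_def
      by (intro monoI add_mono mult_left_mono) auto
    then have "\<lfloor>g y\<rfloor> = \<lfloor>g x\<rfloor>" if "x \<in> {c<..<d}" "y \<in> {c<..<d}" "x \<le> y" for x y
      using floor_le[OF that] floor_mono[OF monoD[OF \<open>mono g\<close> that(3)]] by linarith
    then have floor_eq: "\<lfloor>g y\<rfloor> = \<lfloor>g x\<rfloor>" if "x \<in> {c<..<d}" "y \<in> {c<..<d}" for x y
      using that by (metis linear)
    define e where "e = (c + d) / 2"
    have e: "e \<in> {c<..<d}"
      using assms(2) by (simp add: e_def)
    have "\<beta> * s \<ge> 1 * s"
      using s assms(1) by (intro mult_right_mono) auto
    then have "\<beta> * s + 1 \<ge> real (Suc n)"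
      using s by simp
    moreover have "(beta_map \<alpha> \<beta> ^^ Suc n) 0 = (\<beta> * s + 1) * \<alpha> + (\<beta> * t - of_int \<lfloor>g e\<rfloor>)"
      if "\<alpha> \<in> {c<..<d}" for \<alpha>
      unfolding map_eq[OF that] floor_eq[OF e that] by (simp add: g_def algebra_simps)
    ultimately show ?case
      by blast
  qed (intro exI[of _ 0], simp)
  \<comment> \<open>Any two interior parameters serve: their distance is fixed, while the slope can
    be made as large as desired.\<close>
  obtain x y where xy: "x \<in> {c<..<d}" "y \<in> {c<..<d}" "x < y"
  proof
    show "(2 * c + d) / 3 \<in> {c<..<d}" "(c + 2 * d) / 3 \<in> {c<..<d}" "(2 * c + d) / 3 < (c + 2 * d) / 3"
      using assms(2) by auto
  qed
  obtain n where n: "real n * (y - x) > 1"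
    using reals_Archimedean3[of "y - x"] xy(3) by auto
  from affine[of n] obtain s t where s: "s \<ge> real n"
    and st: "\<And>\<alpha>. \<alpha> \<in> {c<..<d} \<Longrightarrow> (beta_map \<alpha> \<beta> ^^ n) 0 = s * \<alpha> + t"
    by blast
  have "s * x + t \<ge> 0" "s * y + t < 1"
    using st[OF xy(1)] st[OF xy(2)] beta_map_iter_range[of 0 n x \<beta>] beta_map_iter_range[of 0 n y \<beta>]
    by auto
  then have "s * (y - x) < 1"
    by (simp add: algebra_simps)
  moreover have "real n * (y - x) \<le> s * (y - x)"
    using s xy(3) by (intro mult_right_mono) auto
  ultimately show False
    using n by simp
qed

theorem theorem1p6:
  fixes \<beta> :: real
  assumes "\<beta> > 2"
  shows "\<exists>A \<subseteq> {0..<1}. {0..<1} \<subseteq> closure A \<and>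
    (\<forall>\<alpha>\<in>A. \<exists>a b. is_lex_smallest (beta_shift \<alpha> \<beta>) a \<and> is_lex_largest (beta_shift \<alpha> \<beta>) b \<and>
       bdd_above (prefix_lengths b a))"
proof -
  define A where "A = {\<alpha>\<in>{0..<1}. \<exists>m>0. (beta_map \<alpha> \<beta> ^^ m) 0 = 0}"
  have "x \<in> closure A" if "x \<in> {0..<1}" for x
    unfolding closure_approachable
  proof (intro allI impI)
    fix e :: real assume "e > 0"
    \<comment> \<open>The cap at 1 keeps the parameter in [0, 1), and \<open>x + e\<close> keeps it
      within \<open>e\<close> of \<open>x\<close>.\<close>
    then have "1 \<le> \<beta>" "x < min 1 (x + e)"
      using that assms by auto
    then obtain \<alpha> m where "\<alpha> \<in> {x<..<min 1 (x + e)}" "m > 0" "(beta_map \<alpha> \<beta> ^^ m) 0 = 0"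
      using exists_periodic_parameter by blast
    then have "\<alpha> \<in> A" "dist \<alpha> x < e"
      using that by (auto simp: A_def dist_real_def)
    then show "\<exists>y\<in>A. dist y x < e"
      by blast
  qed
  moreover have "\<exists>a b. is_lex_smallest (beta_shift \<alpha> \<beta>) a \<and> is_lex_largest (beta_shift \<alpha> \<beta>) b \<and>
      bdd_above (prefix_lengths b a)" if "\<alpha> \<in> A" for \<alpha>
    using that assms itinerary_0_smallest[of \<alpha> \<beta>] left_itinerary_largest[of \<alpha> \<beta>]
      bdd_above_prefix_lengths_periodic[of \<alpha> \<beta>]
    unfolding A_def by (auto 4 3)
  ultimately show ?thesis
    by (intro exI[of _ A]) (auto simp: A_def)
qed

end
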